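(* Every unital injective algebra endomorphism of $C(\mathbb N^* )$ is a local automorphism, i.e. belongs to $\operatorname{ref}_{al}(\operatorname{Aut}(C(\mathbb N^* )))$. Therefore, the isometry group $\operatorname{Iso}(C(\mathbb N^* ))$ and the automorphism group $\operatorname{Aut}(C(\mathbb N^* ))$ fail to be algebraically reflexive.
   Context: $\mathbb N^*=\beta\mathbb N\setminus\mathbb N$ is the growth of the discrete space $\mathbb N$ in its Stone–Čech compactification $\beta\mathbb N$; it is a compact Hausdorff space. $C(\mathbb N^* )$ is the Banach algebra of continuous scalar-valued functions on $\mathbb N^*$ with the sup-norm (scalars $\mathbb K=\mathbb R$ or $\mathbb C$). For a Banach algebra $\mathscr A$: $\operatorname{Iso}(\mathscr A)$ is the group of all surjective linear isometries; $\operatorname{Aut}(\mathscr A)$ is the group of all continuous (linear) algebra automorphisms; $B(\mathscr A)$ is the algebra of all continuous linear operators on $\mathscr A$. For $\mathscr S\subset B(\mathscr A)$ put $\operatorname{ref}_{al}\mathscr S=\{T\in B(\mathscr A): \text{for every }x\in \mathscr A\text{ there is }L\in\mathscr S\text{ with }Tx=Lx\}$; $\mathscr S$ is algebraically reflexive if $\operatorname{ref}_{al}\mathscr S=\mathscr S$. *)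

theory Defs
  imports "HOL-Analysis.Analysis"
begin

section \<open>Operators on Banach algebras\<close>

text \<open>
  The type classes of the library only provide real scalars. The scalar field is therefore made
  explicit: \<open>s\<close> is the scalar multiplication of the algebra, and linear means linear with
  respect to \<open>s\<close>.
\<close>

definition bounded_ops :: "('k::field \<Rightarrow> 'a \<Rightarrow> 'a) \<Rightarrow> ('a::{banach, real_normed_algebra} \<Rightarrow> 'a) set"
  where "bounded_ops s = {T. Vector_Spaces.linear s s T \<and> continuous_on UNIV T}"

definition Iso :: "('k::field \<Rightarrow> 'a \<Rightarrow> 'a) \<Rightarrow> ('a::{banach, real_normed_algebra} \<Rightarrow> 'a) set"
  where "Iso s = {T. Vector_Spaces.linear s s T \<and> (\<forall>x. norm (T x) = norm x) \<and> surj T}"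

definition algebra_endomorphism ::
    "('k::field \<Rightarrow> 'a \<Rightarrow> 'a) \<Rightarrow> ('a::{banach, real_normed_algebra} \<Rightarrow> 'a) \<Rightarrow> bool"
  where "algebra_endomorphism s T \<longleftrightarrow>
    Vector_Spaces.linear s s T \<and> (\<forall>x y. T (x * y) = T x * T y)"

definition Aut :: "('k::field \<Rightarrow> 'a \<Rightarrow> 'a) \<Rightarrow> ('a::{banach, real_normed_algebra} \<Rightarrow> 'a) set"
  where "Aut s = {T. algebra_endomorphism s T \<and> bij T \<and> continuous_on UNIV T}"

definition ref_al ::
    "('k::field \<Rightarrow> 'a \<Rightarrow> 'a) \<Rightarrow> ('a \<Rightarrow> 'a) set \<Rightarrow> ('a::{banach, real_normed_algebra} \<Rightarrow> 'a) set"
  where "ref_al s S = {T \<in> bounded_ops s. \<forall>x. \<exists>L\<in>S. T x = L x}"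

definition algebraically_reflexive ::
    "('k::field \<Rightarrow> 'a \<Rightarrow> 'a) \<Rightarrow> ('a::{banach, real_normed_algebra} \<Rightarrow> 'a) set \<Rightarrow> bool"
  where "algebraically_reflexive s S \<longleftrightarrow> ref_al s S = S"

lemma Iso_subset_bounded_ops: "Iso s \<subseteq> bounded_ops s"
proof
  fix T assume T: "T \<in> Iso s"
  then have l: "Vector_Spaces.linear s s T" and n: "\<And>x. norm (T x) = norm x"
    by (auto simp: Iso_def)
  have "dist (T x) (T y) = dist x y" for x y
  proof -
    interpret Vector_Spaces.linear s s T by (rule l)
    show ?thesis by (simp add: dist_norm n flip: diff)
  qed
  then have "continuous_on UNIV T"
    by (auto simp: continuous_on_iff)
  with l show "T \<in> bounded_ops s" by (simp add: bounded_ops_def)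
qed

lemma Aut_subset_bounded_ops: "Aut s \<subseteq> bounded_ops s"
  by (auto simp: Aut_def bounded_ops_def algebra_endomorphism_def)


section \<open>The Banach algebra of bounded continuous functions\<close>

text \<open>The library has completeness only for functions on metric spaces.\<close>

instance bcontfun :: (topological_space, complete_space) complete_space
proof
  fix f :: "nat \<Rightarrow> ('a, 'b) bcontfun"
  assume "Cauchy f"
  then obtain g where "uniform_limit UNIV f g sequentially"
    using uniformly_convergent_eq_cauchy[of "\<lambda>_. True" f]
    unfolding Cauchy_def uniform_limit_sequentially_iff
    by (metis dist_fun_lt_imp_dist_val_lt)
  from uniform_limit_bcontfunE[OF this sequentially_bot]
  show "convergent f"
    by (metis convergentI)
qed

instance bcontfun :: (topological_space, banach) banach ..

lemma times_bcontfun_aux: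
  fixes f g :: "'a::topological_space \<Rightarrow> 'b::real_normed_algebra"
  assumes "f \<in> bcontfun" "g \<in> bcontfun"
  shows "(\<lambda>x. f x * g x) \<in> bcontfun"
proof -
  obtain B C where B: "\<And>x. norm (f x) \<le> B" and C: "\<And>x. norm (g x) \<le> C"
    using assms by (auto simp: bcontfun_def bounded_iff)
  have "norm (f x * g x) \<le> B * C" for x
  proof -
    have "norm (f x * g x) \<le> norm (f x) * norm (g x)"
      by (rule norm_mult_ineq)
    also have "\<dots> \<le> B * C"
      by (intro mult_mono B C order_trans[OF norm_ge_zero B] norm_ge_zero)
    finally show ?thesis .
  qed
  then show ?thesis
    using assms by (intro bcontfun_normI) (auto simp: bcontfun_def intro!: continuous_intros)
qed

instantiation bcontfun :: (topological_space, real_normed_algebra) real_normed_algebra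
begin

definition times_bcontfun :: "('a \<Rightarrow>\<^sub>C 'b) \<Rightarrow> ('a \<Rightarrow>\<^sub>C 'b) \<Rightarrow> 'a \<Rightarrow>\<^sub>C 'b"
  where "times_bcontfun f g = Bcontfun (\<lambda>x. f x * g x)"

lemma apply_times_bcontfun [simp]: "apply_bcontfun (f * g) x = f x * g x"
  for f g :: "'a \<Rightarrow>\<^sub>C 'b"
  unfolding times_bcontfun_def
  by (subst Bcontfun_inverse) (auto intro!: times_bcontfun_aux apply_bcontfun)

instance
proof
  fix f g h :: "'a \<Rightarrow>\<^sub>C 'b" and a :: real
  show "f * g * h = f * (g * h)" "(f + g) * h = f * h + g * h" "f * (g + h) = f * g + f * h"
    "(a *\<^sub>R f) * g = a *\<^sub>R (f * g)" "f * (a *\<^sub>R g) = a *\<^sub>R (f * g)"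
    by (auto intro!: bcontfun_eqI simp: algebra_simps)
  show "norm (f * g) \<le> norm f * norm g"
  proof (rule norm_bound)
    fix x
    have "norm (f x * g x) \<le> norm (f x) * norm (g x)"
      by (rule norm_mult_ineq)
    also have "\<dots> \<le> norm f * norm g"
      by (intro mult_mono norm_bounded norm_ge_zero)
    finally show "norm (apply_bcontfun (f * g) x) \<le> norm f * norm g" by simp
  qed
qed

end

instantiation bcontfun :: (topological_space, real_normed_algebra_1) real_normed_algebra_1
begin

definition one_bcontfun :: "'a \<Rightarrow>\<^sub>C 'b"
  where "one_bcontfun = const_bcontfun 1"

lemma apply_one_bcontfun [simp]: "apply_bcontfun (1 :: 'a \<Rightarrow>\<^sub>C 'b) x = 1"
  by (simp add: one_bcontfun_def)

instance
proof
  fix f :: "'a \<Rightarrow>\<^sub>C 'b"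
  show "1 * f = f" "f * 1 = f"
    by (auto intro!: bcontfun_eqI)
  show "(0 :: 'a \<Rightarrow>\<^sub>C 'b) \<noteq> 1"
    by (metis apply_one_bcontfun zero_bcontfun.rep_eq zero_neq_one)
  show "norm (1 :: 'a \<Rightarrow>\<^sub>C 'b) = 1"
  proof (rule antisym)
    show "norm (1 :: 'a \<Rightarrow>\<^sub>C 'b) \<le> 1"
      by (rule norm_bound) simp
    show "1 \<le> norm (1 :: 'a \<Rightarrow>\<^sub>C 'b)"
      using norm_bounded[of "1 :: 'a \<Rightarrow>\<^sub>C 'b" undefined] by simp
  qed
qed

end

definition scale_bcontfun ::
    "'k::real_normed_field \<Rightarrow> ('a::topological_space \<Rightarrow>\<^sub>C 'k) \<Rightarrow> ('a \<Rightarrow>\<^sub>C 'k)"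
  where "scale_bcontfun c f = const_bcontfun c * f"

lemma apply_scale_bcontfun [simp]: "apply_bcontfun (scale_bcontfun c f) x = c * f x"
  by (simp add: scale_bcontfun_def)

lemma vector_space_scale_bcontfun: "vector_space scale_bcontfun"
  by unfold_locales (auto intro!: bcontfun_eqI simp: algebra_simps)

lemma scale_bcontfun_real: "scale_bcontfun = (scaleR :: real \<Rightarrow> ('a::topological_space \<Rightarrow>\<^sub>C real) \<Rightarrow> _)"
  by (intro ext bcontfun_eqI) simp


section \<open>The Stone--Cech compactification of the natural numbers\<close>

definition is_ultrafilter :: "'a filter \<Rightarrow> bool"
  where "is_ultrafilter F \<longleftrightarrow> F \<noteq> bot \<and> (\<forall>P. eventually P F \<or> eventually (\<lambda>x. \<not> P x) F)"

lemma is_ultrafilter_principal: "is_ultrafilter (principal {n})"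
  by (auto simp: is_ultrafilter_def eventually_principal trivial_limit_def)

lemma is_ultrafilter_not_iff:
  assumes "is_ultrafilter F"
  shows "eventually (\<lambda>x. \<not> P x) F \<longleftrightarrow> \<not> eventually P F"
proof
  assume "eventually (\<lambda>x. \<not> P x) F"
  show "\<not> eventually P F"
  proof
    assume "eventually P F"
    with \<open>eventually (\<lambda>x. \<not> P x) F\<close> have "eventually (\<lambda>x. False) F"
      by eventually_elim auto
    with assms show False by (simp add: is_ultrafilter_def trivial_limit_def)
  qed
qed (use assms in \<open>auto simp: is_ultrafilter_def\<close>)

lemma ex_ultrafilter_le:
  assumes "F \<noteq> bot"
  shows "\<exists>U\<le>F. is_ultrafilter U"
proof -
  define A where "A = {G. G \<noteq> bot \<and> G \<le> F}"
  have "\<exists>m\<in>A. \<forall>a\<in>A. m \<ge> a \<longrightarrow> a = m"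
  proof (rule predicate_Zorn)
    show "partial_order_on A (relation_of (\<ge>) A)"
      by (rule partial_order_on_relation_ofI) auto
    fix C assume C: "C \<in> Chains (relation_of (\<ge>) A)"
    show "\<exists>u\<in>A. \<forall>a\<in>C. u \<le> a"
    proof (cases "C = {}")
      case True
      with assms show ?thesis by (auto simp: A_def)
    next
      case False
      have CA: "C \<subseteq> A" and tot: "\<And>x y. x \<in> C \<Longrightarrow> y \<in> C \<Longrightarrow> x \<le> y \<or> y \<le> x"
        using C by (auto simp: Chains_def relation_of_def)
      have "eventually P (Inf C) \<longleftrightarrow> (\<exists>b\<in>C. eventually P b)" for P
        using False by (rule eventually_Inf_base) (use tot in \<open>metis inf.orderE inf.commute order_refl\<close>)
      then have "Inf C \<noteq> bot"
        using CA by (auto simp: trivial_limit_def A_def)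
      moreover have "Inf C \<le> F"
        using False CA by (auto simp: A_def intro: Inf_lower2)
      ultimately show ?thesis
        by (auto simp: A_def intro!: bexI[of _ "Inf C"] Inf_lower)
    qed
  qed
  then obtain U where U: "U \<noteq> bot" "U \<le> F"
    and max: "\<And>G. G \<noteq> bot \<Longrightarrow> G \<le> F \<Longrightarrow> G \<le> U \<Longrightarrow> G = U"
    by (auto simp: A_def)
  have "eventually P U \<or> eventually (\<lambda>x. \<not> P x) U" for P
  proof (rule disjCI)
    assume "\<not> eventually (\<lambda>x. \<not> P x) U"
    then have "inf U (principal {x. P x}) \<noteq> bot"
      by (simp add: trivial_limit_def eventually_inf_principal)
    then have "inf U (principal {x. P x}) = U"
      by (rule max) (use U(2) in \<open>auto intro: le_infI1\<close>)
    then have "U \<le> principal {x. P x}"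
      by (simp add: le_iff_inf)
    then show "eventually P U"
      by (simp add: le_principal)
  qed
  with U show ?thesis by (auto simp: is_ultrafilter_def)
qed

text \<open>
  We use the standard construction of \<open>\<beta>\<nat>\<close> as the space of all ultrafilters on the natural
  numbers; the sets of all ultrafilters containing a fixed set form a base of the topology. The
  facts below show that it is a compact Hausdorff space which contains the discrete space
  \<open>\<nat>\<close> densely and has the extension property of the Stone--Cech compactification.
\<close>

typedef beta_nat = "{F :: nat filter. is_ultrafilter F}"
  morphisms filter_of Beta_nat
  by (rule exI, rule CollectI, rule is_ultrafilter_principal)

definition beta_basic :: "nat set \<Rightarrow> beta_nat set"
  where "beta_basic A = {p. eventually (\<lambda>n. n \<in> A) (filter_of p)}"

definition nat_point :: "nat \<Rightarrow> beta_nat"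
  where "nat_point n = Beta_nat (principal {n})"

lemma ultrafilter_filter_of: "is_ultrafilter (filter_of p)"
  using filter_of[of p] by simp

lemma filter_of_nat_point: "filter_of (nat_point n) = principal {n}"
  by (simp add: nat_point_def Beta_nat_inverse is_ultrafilter_principal)

lemma beta_basic_Int: "beta_basic A \<inter> beta_basic B = beta_basic (A \<inter> B)"
  by (auto simp: beta_basic_def eventually_conj_iff)

lemma beta_basic_Compl: "beta_basic (- A) = - beta_basic A"
  by (auto simp: beta_basic_def is_ultrafilter_not_iff[OF ultrafilter_filter_of])

lemma beta_basic_UNIV: "beta_basic UNIV = UNIV"
  by (simp add: beta_basic_def)

lemma nat_point_in_beta_basic [simp]: "nat_point n \<in> beta_basic A \<longleftrightarrow> n \<in> A"
  by (simp add: beta_basic_def filter_of_nat_point eventually_principal)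

instantiation beta_nat :: topological_space
begin

definition open_beta_nat :: "beta_nat set \<Rightarrow> bool"
  where "open_beta_nat U \<longleftrightarrow> (\<forall>p\<in>U. \<exists>A. p \<in> beta_basic A \<and> beta_basic A \<subseteq> U)"

instance
proof
  show "open (UNIV :: beta_nat set)"
    using beta_basic_UNIV by (auto simp: open_beta_nat_def)
next
  fix S T :: "beta_nat set"
  assume S: "open S" and T: "open T"
  show "open (S \<inter> T)"
    unfolding open_beta_nat_def
  proof
    fix p assume "p \<in> S \<inter> T"
    with S T obtain A B where "p \<in> beta_basic A" "beta_basic A \<subseteq> S" "p \<in> beta_basic B" "beta_basic B \<subseteq> T"
      by (meson IntD1 IntD2 open_beta_nat_def)
    then show "\<exists>C. p \<in> beta_basic C \<and> beta_basic C \<subseteq> S \<inter> T"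
      by (intro exI[of _ "A \<inter> B"]) (auto simp flip: beta_basic_Int)
  qed
next
  fix K :: "beta_nat set set"
  assume "\<forall>S\<in>K. open S"
  then show "open (\<Union>K)"
    unfolding open_beta_nat_def by (meson Union_iff Sup_upper subset_trans)
qed

end

lemma open_beta_basic: "open (beta_basic A)"
  by (auto simp: open_beta_nat_def)

lemma closed_beta_basic: "closed (beta_basic A)"
  using open_beta_basic[of "- A"] by (simp add: closed_def beta_basic_Compl)

instance beta_nat :: t2_space
proof
  fix p q :: beta_nat
  assume "p \<noteq> q"
  then have "filter_of p \<noteq> filter_of q"
    by (simp add: filter_of_inject)
  then obtain P where "eventually P (filter_of p) \<noteq> eventually P (filter_of q)"
    by (auto simp: filter_eq_iff)
  then have "p \<in> beta_basic {n. P n} \<and> q \<in> beta_basic (- {n. P n}) \<or>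
      q \<in> beta_basic {n. P n} \<and> p \<in> beta_basic (- {n. P n})"
    unfolding beta_basic_Compl by (auto simp: beta_basic_def)
  moreover have "beta_basic {n. P n} \<inter> beta_basic (- {n. P n}) = {}"
    by (simp add: beta_basic_Compl)
  ultimately show "\<exists>U V. open U \<and> open V \<and> p \<in> U \<and> q \<in> V \<and> U \<inter> V = {}"
    using open_beta_basic by (metis inf_commute)
qed

lemma compact_beta_nat: "compact (UNIV :: beta_nat set)"
proof (rule compactI)
  fix C :: "beta_nat set set"
  assume op: "\<forall>c\<in>C. open c" and cov: "UNIV \<subseteq> \<Union>C"
  show "\<exists>C'\<subseteq>C. finite C' \<and> UNIV \<subseteq> \<Union>C'"
  proof (rule ccontr)
    assume no: "\<not> (\<exists>C'\<subseteq>C. finite C' \<and> UNIV \<subseteq> \<Union>C')"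
    define \<A> where "\<A> = {A. \<exists>c\<in>C. beta_basic A \<subseteq> c}"
    have "(INF A\<in>\<A>. principal (- A)) \<noteq> bot"
    proof (rule INF_filter_not_bot)
      fix X assume X: "X \<subseteq> \<A>" "finite X"
      show "(INF A\<in>X. principal (- A)) \<noteq> bot"
      proof
        assume "(INF A\<in>X. principal (- A)) = bot"
        then have U: "\<Union>X = UNIV"
          using X(2) by (auto simp: INF_principal_finite principal_eq_bot_iff)
        have "\<forall>A\<in>X. \<exists>c. c \<in> C \<and> beta_basic A \<subseteq> c"
          using X(1) by (auto simp: \<A>_def)
        then obtain c where c: "\<forall>A\<in>X. c A \<in> C \<and> beta_basic A \<subseteq> c A"
          by (rule bchoice[THEN exE])
        have "UNIV \<subseteq> \<Union>(c ` X)"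
        proof
          fix p
          have "\<exists>A\<in>X. p \<in> beta_basic A"
          proof (rule ccontr)
            assume "\<not> (\<exists>A\<in>X. p \<in> beta_basic A)"
            then have "\<forall>A\<in>X. eventually (\<lambda>n. n \<notin> A) (filter_of p)"
              by (auto simp: beta_basic_def is_ultrafilter_not_iff[OF ultrafilter_filter_of])
            then have "eventually (\<lambda>n. \<forall>A\<in>X. n \<notin> A) (filter_of p)"
              using X(2) by (simp add: eventually_ball_finite)
            moreover have "\<not> (\<forall>A\<in>X. n \<notin> A)" for n
              using U by blast
            ultimately have "eventually (\<lambda>n. False) (filter_of p)"
              by simp
            with ultrafilter_filter_of[of p] show False
              unfolding is_ultrafilter_def trivial_limit_def by blast
          qed
          then show "p \<in> \<Union>(c ` X)"
            using c by blast
        qed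
        moreover have "c ` X \<subseteq> C" "finite (c ` X)"
          using c X(2) by auto
        ultimately show False
          using no by blast
      qed
    qed
    then obtain U where le: "U \<le> (INF A\<in>\<A>. principal (- A))" and U: "is_ultrafilter U"
      using ex_ultrafilter_le by blast
    have fU: "filter_of (Beta_nat U) = U"
      using U by (simp add: Beta_nat_inverse)
    obtain c where "c \<in> C" "Beta_nat U \<in> c"
      using cov by auto
    with op obtain A where A: "Beta_nat U \<in> beta_basic A" "beta_basic A \<subseteq> c"
      by (meson open_beta_nat_def)
    with \<open>c \<in> C\<close> have "A \<in> \<A>"
      by (auto simp: \<A>_def)
    then have "U \<le> principal (- A)"
      using le by (meson INF_lower order_trans)
    then have "eventually (\<lambda>n. n \<notin> A) U"
      by (simp add: le_principal)
    with A(1) U show False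
      by (simp add: beta_basic_def fU is_ultrafilter_not_iff)
  qed
qed

lemma inj_nat_point: "inj nat_point"
  by (rule injI) (metis nat_point_in_beta_basic singleton_iff)

lemma beta_basic_singleton: "beta_basic {n} = {nat_point n}"
proof -
  have "p = nat_point n" if "p \<in> beta_basic {n}" for p
  proof (rule ccontr)
    assume "p \<noteq> nat_point n"
    then obtain U where U: "open U" "nat_point n \<in> U" "p \<notin> U"
      by (metis t1_space)
    then obtain A where A: "nat_point n \<in> beta_basic A" "beta_basic A \<subseteq> U"
      by (meson open_beta_nat_def)
    then have "n \<in> A" by simp
    have "eventually (\<lambda>m. m = n) (filter_of p)"
      using that by (simp add: beta_basic_def)
    then have "p \<in> beta_basic A"
      unfolding beta_basic_def mem_Collect_eq by eventually_elim (use \<open>n \<in> A\<close> in simp)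
    with A U(3) show False by auto
  qed
  then show ?thesis by auto
qed

lemma open_nat_point: "open {nat_point n}"
  using open_beta_basic[of "{n}"] by (simp add: beta_basic_singleton)

lemma dense_nat_point: "closure (range nat_point) = UNIV"
proof -
  have "p \<in> closure (range nat_point)" for p
    unfolding closure_iff_nhds_not_empty
  proof (intro allI impI)
    fix S U assume "U \<subseteq> S" "open U" "p \<in> U"
    then obtain A where A: "p \<in> beta_basic A" "beta_basic A \<subseteq> U"
      by (meson open_beta_nat_def)
    have "A \<noteq> {}"
      using A(1) ultrafilter_filter_of[of p]
      by (auto simp: beta_basic_def is_ultrafilter_def trivial_limit_def)
    then obtain n where "n \<in> A" by auto
    then have "nat_point n \<in> beta_basic A" by simp
    then have "nat_point n \<in> S"
      using A(2) \<open>U \<subseteq> S\<close> by blast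
    then show "range nat_point \<inter> S \<noteq> {}" by auto
  qed
  then show ?thesis by auto
qed

lemma compact_ultrafilter_limit:
  assumes Y: "compact_space Y" and U: "is_ultrafilter U" and f: "range f \<subseteq> topspace Y"
  shows "\<exists>l. limitin Y f l U"
proof (rule ccontr)
  assume no: "\<not> (\<exists>l. limitin Y f l U)"
  define \<V> where "\<V> = {V. openin Y V \<and> eventually (\<lambda>n. f n \<notin> V) U}"
  have "topspace Y \<subseteq> \<Union>\<V>"
    using no by (auto simp: limitin_def \<V>_def is_ultrafilter_not_iff[OF U])
  moreover have "\<forall>V\<in>\<V>. openin Y V"
    by (simp add: \<V>_def)
  ultimately obtain \<F> where F: "finite \<F>" "\<F> \<subseteq> \<V>" "topspace Y \<subseteq> \<Union>\<F>"
    using Y unfolding compact_space_alt by meson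
  have "eventually (\<lambda>n. \<forall>V\<in>\<F>. f n \<notin> V) U"
    using F(1,2) by (intro eventually_ball_finite) (auto simp: \<V>_def)
  moreover have "\<not> (\<forall>V\<in>\<F>. f n \<notin> V)" for n
    using F(3) f by blast
  ultimately have "eventually (\<lambda>n. False) U"
    by simp
  with U show False
    unfolding is_ultrafilter_def trivial_limit_def by blast
qed

theorem beta_nat_extension:
  assumes Y: "compact_space Y" "Hausdorff_space Y" and f: "range f \<subseteq> topspace Y"
  shows "\<exists>g. continuous_map euclidean Y g \<and> (\<forall>n. g (nat_point n) = f n)"
proof -
  obtain g where g: "\<And>p. limitin Y f (g p) (filter_of p)"
    using compact_ultrafilter_limit[OF Y(1) ultrafilter_filter_of f] by metis
  have "g (nat_point n) = f n" for n
  proof (rule limitin_Hausdorff_unique)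
    show "limitin Y f (g (nat_point n)) (principal {n})"
      using g[of "nat_point n"] by (simp add: filter_of_nat_point)
    show "limitin Y f (f n) (principal {n})"
      using f by (auto simp: limitin_def eventually_principal)
  qed (use Y in \<open>auto simp: trivial_limit_def eventually_principal\<close>)
  moreover have "continuous_map euclidean Y g"
    unfolding continuous_map_def
  proof (intro conjI allI impI)
    show "g \<in> topspace euclidean \<rightarrow> topspace Y"
      using g by (auto simp: limitin_def)
    fix W assume W: "openin Y W"
    have "open {p. g p \<in> W}"
      unfolding open_beta_nat_def
    proof safe
      fix p assume "g p \<in> W"
      have "neighbourhood_base_of (closedin Y) Y"
        using compact_Hausdorff_imp_regular_space[OF Y] by (simp add: neighbourhood_base_of_closedin)
      with W \<open>g p \<in> W\<close> obtain V K where V: "openin Y V" "closedin Y K" "g p \<in> V" "V \<subseteq> K" "K \<subseteq> W"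
        unfolding neighbourhood_base_of by meson
      show "\<exists>A. p \<in> beta_basic A \<and> beta_basic A \<subseteq> {p. g p \<in> W}"
      proof (intro exI conjI subsetI)
        show "p \<in> beta_basic {n. f n \<in> V}"
          using g[of p] V by (auto simp: limitin_def beta_basic_def)
        fix q assume "q \<in> beta_basic {n. f n \<in> V}"
        then have "eventually (\<lambda>n. f n \<in> K) (filter_of q)"
          using V(4) by (auto simp: beta_basic_def elim: eventually_mono)
        then have "g q \<in> K"
          using limitin_closedin[OF g[of q] V(2)] ultrafilter_filter_of[of q]
          by (auto simp: is_ultrafilter_def)
        with V(5) show "q \<in> {p. g p \<in> W}" by auto
      qed
    qed
    then show "openin euclidean {x \<in> topspace euclidean. g x \<in> W}"
      by simp
  qed
  ultimately show ?thesis by blast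
qed


section \<open>The growth of the natural numbers\<close>

lemma range_nat_point_neq_UNIV: "range nat_point \<noteq> UNIV"
proof
  assume eq: "range nat_point = UNIV"
  obtain N where N: "finite N" "UNIV \<subseteq> (\<Union>n\<in>N. {nat_point n})"
  proof (rule compactE_image[OF compact_beta_nat, of UNIV "\<lambda>n. {nat_point n}"])
    show "UNIV \<subseteq> (\<Union>n\<in>UNIV. {nat_point n})"
      using eq by auto
  qed (auto simp: open_nat_point)
  then have "UNIV \<subseteq> N"
    using inj_nat_point by (auto simp: inj_on_def)
  with N(1) show False
    using infinite_UNIV_nat finite_subset by blast
qed

typedef nat_star = "UNIV - range nat_point"
  morphisms beta_of Nat_star
  using range_nat_point_neq_UNIV by auto

instantiation nat_star :: topological_space
begin

definition open_nat_star :: "nat_star set \<Rightarrow> bool"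
  where "open_nat_star U \<longleftrightarrow> (\<exists>V. open V \<and> U = beta_of -` V)"

instance
proof
  show "open (UNIV :: nat_star set)"
    by (auto simp: open_nat_star_def intro!: exI[of _ UNIV])
next
  fix S T :: "nat_star set"
  assume "open S" "open T"
  then obtain V W where "open V" "S = beta_of -` V" "open W" "T = beta_of -` W"
    by (auto simp: open_nat_star_def)
  then show "open (S \<inter> T)"
    by (auto simp: open_nat_star_def intro!: exI[of _ "V \<inter> W"])
next
  fix K :: "nat_star set set"
  assume "\<forall>S\<in>K. open S"
  then have "\<forall>S\<in>K. \<exists>V. open V \<and> S = beta_of -` V"
    by (simp add: open_nat_star_def)
  then obtain V where V: "\<forall>S\<in>K. open (V S) \<and> S = beta_of -` V S"
    by (rule bchoice[THEN exE])
  have "x \<in> S \<longleftrightarrow> beta_of x \<in> V S" if "S \<in> K" for S x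
    using V that by blast
  then have "\<Union>K = beta_of -` (\<Union>S\<in>K. V S)"
    by auto
  moreover have "open (\<Union>S\<in>K. V S)"
    using V by auto
  ultimately show "open (\<Union>K)"
    unfolding open_nat_star_def by blast
qed

end

instance nat_star :: t2_space
proof
  fix p q :: nat_star
  assume "p \<noteq> q"
  then have "beta_of p \<noteq> beta_of q"
    by (simp add: beta_of_inject)
  then obtain U V where UV: "open U" "open V" "beta_of p \<in> U" "beta_of q \<in> V" "U \<inter> V = {}"
    by (meson hausdorff)
  have "open (beta_of -` U)" "open (beta_of -` V)"
    using UV by (auto simp: open_nat_star_def)
  with UV show "\<exists>U V. open U \<and> open V \<and> p \<in> U \<and> q \<in> V \<and> U \<inter> V = {}"
    by (intro exI[of _ "beta_of -` U"] exI[of _ "beta_of -` V"]) auto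
qed

lemma compact_nat_star: "compact (UNIV :: nat_star set)"
proof (rule compactI)
  fix C :: "nat_star set set"
  assume op: "\<forall>c\<in>C. open c" and cov: "UNIV \<subseteq> \<Union>C"
  have "\<forall>c\<in>C. \<exists>V. open V \<and> c = beta_of -` V"
    using op by (simp add: open_nat_star_def)
  then obtain V where V: "\<forall>c\<in>C. open (V c) \<and> c = beta_of -` V c"
    by (rule bchoice[THEN exE])
  have mem: "x \<in> c \<longleftrightarrow> beta_of x \<in> V c" if "c \<in> C" for c x
    using V that by blast
  have "open (\<Union>n. {nat_point n})"
    by (intro open_UN ballI open_nat_point)
  then have "open (range nat_point)"
    by (simp only: UNION_singleton_eq_range)
  then have "compact (UNIV - range nat_point)"
    by (rule compact_diff[OF compact_beta_nat])
  then obtain D where D: "D \<subseteq> C" "finite D" "UNIV - range nat_point \<subseteq> (\<Union>c\<in>D. V c)"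
  proof (rule compactE_image)
    show "open (V c)" if "c \<in> C" for c
      using V that by simp
    show "UNIV - range nat_point \<subseteq> (\<Union>c\<in>C. V c)"
    proof
      fix p assume "p \<in> UNIV - range nat_point"
      then have p: "beta_of (Nat_star p) = p"
        by (simp add: Nat_star_inverse)
      obtain c where "c \<in> C" "Nat_star p \<in> c"
        using cov by auto
      then show "p \<in> (\<Union>c\<in>C. V c)"
        using mem p by auto
    qed
  qed
  have "UNIV \<subseteq> \<Union>D"
  proof
    fix x
    obtain c where "c \<in> D" "beta_of x \<in> V c"
      using D(3) beta_of[of x] by blast
    then show "x \<in> \<Union>D"
      using mem D(1) by blast
  qed
  with D show "\<exists>C'\<subseteq>C. finite C' \<and> UNIV \<subseteq> \<Union>C'"
    by blast
qed

text \<open>Consequently \<open>nat_star \<Rightarrow>\<^sub>C 'k\<close> consists of all continuous functions.\<close>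

lemma continuous_nat_star_bcontfun:
  fixes f :: "nat_star \<Rightarrow> 'k::metric_space"
  assumes "continuous_on UNIV f"
  shows "f \<in> bcontfun"
  using compact_imp_bounded[OF compact_continuous_image[OF assms compact_nat_star]] assms
  by (simp add: bcontfun_def)

end

theory Submission
  imports Defs
begin

text \<open>
  A character of \<open>C(K)\<close>, for compact \<open>K\<close>, is evaluation at a point
  (\<open>character_is_evaluation\<close>). Hence a unital endomorphism of \<open>C(\<nat>\<^sup>*)\<close> has the form
  \<open>f \<mapsto> f \<circ> \<phi>\<close> with \<open>\<phi>\<close> continuous, and it is injective only if \<open>\<phi>\<close> is onto. The
  functions \<open>f \<circ> \<phi>\<close> and \<open>f\<close> then have the same range, and it remains to see that two
  continuous functions \<open>f\<close> and \<open>g\<close> on \<open>\<nat>\<^sup>*\<close> with the same range differ only by a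
  homeomorphism of \<open>\<nat>\<^sup>*\<close>.

  This last claim (\<open>same_range_imp_permutation\<close>) is about sequences. By Tietze, \<open>f\<close> and \<open>g\<close>
  are the boundary values of continuous functions on \<open>\<beta>\<nat>\<close>, that is, of sequences \<open>x\<close> and
  \<open>y\<close>: the value at \<open>p\<close> is the limit along the ultrafilter \<open>p\<close>. The range of \<open>f\<close> is the
  set of cluster points of \<open>x\<close>, and \<open>x\<close> approaches it. As the cluster points of \<open>x\<close> and \<open>y\<close>
  agree, every term of \<open>y\<close> has, arbitrarily far out, terms of \<open>x\<close> whose distance to it is almost its
  distance to the common cluster set, and vice versa. So there are injections of the index
  sets in both directions which match terms up to a null sequence. The Schroeder--Bernstein
  construction merges them into a permutation \<open>\<sigma>\<close> with \<open>y n - x (\<sigma> n) \<longlonglongrightarrow> 0\<close>, and such a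
  \<open>\<sigma>\<close> induces a homeomorphism of \<open>\<nat>\<^sup>*\<close> which carries \<open>f\<close> to \<open>g\<close>. Composition with this
  homeomorphism is both an automorphism and an isometry.

  Reflexivity thus fails as soon as some continuous surjection of \<open>\<nat>\<^sup>*\<close> onto itself is not
  injective. One is induced by \<open>n \<mapsto> n div 2\<close>: it identifies the images of \<open>\<nat>\<^sup>*\<close> under
  \<open>n \<mapsto> 2 * n\<close> and \<open>n \<mapsto> 2 * n + 1\<close>, so that the corresponding composition operator
  misses the indicator function of the even numbers.

  The arguments are uniform in the scalars: they are carried out for a normed field which is
  also a Euclidean space, the latter for the Tietze theorem and for nearest points in closed sets.
\<close>

section \<open>Characters of algebras of continuous functions\<close>

text \<open>
  For real and complex scalars this is complex conjugation. The formula makes sense in every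
  normed field; at \<open>0\<close> the value is \<open>0\<close> because division by zero yields zero, which is also what
  continuity demands.
\<close>

definition conjugate_like :: "'k::real_normed_field \<Rightarrow> 'k"
  where "conjugate_like z = of_real ((norm z)\<^sup>2) / z"

lemma conjugate_like_mult: "conjugate_like z * z = of_real ((norm z)\<^sup>2)"
  by (simp add: conjugate_like_def)

lemma norm_conjugate_like: "norm (conjugate_like z) = norm z"
  by (cases "z = 0") (simp_all add: conjugate_like_def norm_divide power2_eq_square norm_mult)

lemma continuous_on_conjugate_like:
  "continuous_on UNIV (conjugate_like :: 'k::real_normed_field \<Rightarrow> 'k)"
proof (rule continuous_at_imp_continuous_on, rule ballI)
  fix z :: 'k
  show "isCont (conjugate_like :: 'k \<Rightarrow> 'k) z"
  proof (cases "z = 0")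
    case True
    have "((\<lambda>w::'k. norm (conjugate_like w)) \<longlongrightarrow> 0) (at 0)"
      unfolding norm_conjugate_like by (rule tendsto_norm_zero) (rule tendsto_ident_at)
    then show ?thesis
      using True norm_conjugate_like[of "0 :: 'k"]
      by (simp add: isCont_def tendsto_norm_zero_iff)
  next
    case False
    then show ?thesis
      unfolding conjugate_like_def by (intro continuous_intros) auto
  qed
qed

lemma continuous_compact_bcontfun:
  fixes f :: "'a::topological_space \<Rightarrow> 'b::metric_space"
  assumes "compact (UNIV :: 'a set)" "continuous_on UNIV f"
  shows "f \<in> bcontfun"
  using compact_imp_bounded[OF compact_continuous_image[OF assms(2,1)]] assms(2)
  by (simp add: bcontfun_def)

lemma apply_bcontfun_sum:
  fixes F :: "'i \<Rightarrow> 'a::topological_space \<Rightarrow>\<^sub>C 'b::real_normed_vector"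
  shows "apply_bcontfun (sum F I) x = (\<Sum>i\<in>I. apply_bcontfun (F i) x)"
  by (induction I rule: infinite_finite_induct) auto

text \<open>
  Only the kernel matters: if all members of the kernel vanish at \<open>p\<close>, then
  \<open>f - \<omega> f\<close> vanishes at \<open>p\<close>. Without such a common zero, compactness gives finitely many
  members \<open>f\<close> of the kernel that have no common zero, and the sum of their squared moduli would be
  an invertible member of the kernel.
\<close>

theorem character_is_evaluation:
  fixes \<omega> :: "('a::topological_space \<Rightarrow>\<^sub>C 'k::real_normed_field) \<Rightarrow> 'k"
  assumes K: "compact (UNIV :: 'a set)"
    and add: "\<And>f g. \<omega> (f + g) = \<omega> f + \<omega> g"
    and scale: "\<And>c f. \<omega> (scale_bcontfun c f) = c * \<omega> f"
    and mult: "\<And>f g. \<omega> (f * g) = \<omega> f * \<omega> g"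
    and one: "\<omega> 1 = 1"
  obtains p where "\<And>f. \<omega> f = f p"
proof -
  have zero: "\<omega> 0 = 0"
    using add[of 0 0] by simp
  have "\<exists>p. \<forall>f. \<omega> f = 0 \<longrightarrow> apply_bcontfun f p = 0"
  proof (rule ccontr)
    assume "\<nexists>p. \<forall>f. \<omega> f = 0 \<longrightarrow> apply_bcontfun f p = 0"
    then have ex: "\<And>p. \<exists>f. \<omega> f = 0 \<and> apply_bcontfun f p \<noteq> 0"
      by blast
    obtain D where D: "D \<subseteq> {f. \<omega> f = 0}" "finite D" "UNIV \<subseteq> (\<Union>f\<in>D. {p. apply_bcontfun f p \<noteq> 0})"
    proof (rule compactE_image[OF K, of "{f. \<omega> f = 0}" "\<lambda>f. {p. apply_bcontfun f p \<noteq> 0}"])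
      show "open {p. apply_bcontfun f p \<noteq> 0}" for f :: "'a \<Rightarrow>\<^sub>C 'k"
        by (intro open_Collect_neq continuous_intros) auto
    qed (use ex in auto)
    define conj where "conj f = Bcontfun (\<lambda>p. conjugate_like (apply_bcontfun f p))" for f :: "'a \<Rightarrow>\<^sub>C 'k"
    have conj: "apply_bcontfun (conj f) p = conjugate_like (apply_bcontfun f p)" for f p
      unfolding conj_def
      by (subst Bcontfun_inverse)
        (auto intro!: continuous_compact_bcontfun[OF K]
          continuous_on_compose2[OF continuous_on_conjugate_like])
    define g where "g = (\<Sum>f\<in>D. conj f * f)"
    have g_eq: "apply_bcontfun g p = of_real (\<Sum>f\<in>D. (norm (apply_bcontfun f p))\<^sup>2)" for p
      by (simp add: g_def apply_bcontfun_sum conj conjugate_like_mult)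
    have g_nz: "apply_bcontfun g p \<noteq> 0" for p
    proof -
      obtain f where f: "f \<in> D" "apply_bcontfun f p \<noteq> 0"
        using D(3) by auto
      then have "(\<Sum>f\<in>D. (norm (apply_bcontfun f p))\<^sup>2) > 0"
        using D(2) by (intro sum_pos2[of D f]) auto
      then show ?thesis
        unfolding g_eq by (simp del: of_real_sum)
    qed
    have "\<omega> (sum h E) = (\<Sum>f\<in>E. \<omega> (h f))" for h :: "('a \<Rightarrow>\<^sub>C 'k) \<Rightarrow> _" and E
      by (induction E rule: infinite_finite_induct) (auto simp: zero add)
    then have "\<omega> g = 0"
      using D(1) by (auto simp: g_def mult intro!: sum.neutral)
    moreover have "g * Bcontfun (\<lambda>p. inverse (apply_bcontfun g p)) = 1"
      by (rule bcontfun_eqI)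
        (simp add: Bcontfun_inverse continuous_compact_bcontfun[OF K] continuous_on_inverse g_nz)
    ultimately show False
      using mult one by (metis mult_zero_left zero_neq_one)
  qed
  then obtain p where p: "\<And>f. \<omega> f = 0 \<Longrightarrow> apply_bcontfun f p = 0"
    by blast
  have "\<omega> f = apply_bcontfun f p" for f
  proof -
    have "\<omega> (f + scale_bcontfun (- \<omega> f) 1) = 0"
      by (simp only: add scale one) simp
    from p[OF this] show ?thesis by simp
  qed
  with that show ?thesis by blast
qed


section \<open>Points of the growth as free ultrafilters\<close>

definition ultrafilter_at :: "nat_star \<Rightarrow> nat filter"
  where "ultrafilter_at p = filter_of (beta_of p)"

definition star_basic :: "nat set \<Rightarrow> nat_star set"
  where "star_basic A = {p. eventually (\<lambda>n. n \<in> A) (ultrafilter_at p)}"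

lemma star_basic_eq_vimage: "star_basic A = beta_of -` beta_basic A"
  by (auto simp: star_basic_def beta_basic_def ultrafilter_at_def)

lemma is_ultrafilter_ultrafilter_at: "is_ultrafilter (ultrafilter_at p)"
  by (simp add: ultrafilter_at_def ultrafilter_filter_of)

lemma ultrafilter_at_neq_bot: "ultrafilter_at p \<noteq> bot"
  using is_ultrafilter_ultrafilter_at by (auto simp: is_ultrafilter_def)

lemma ultrafilter_at_inject: "ultrafilter_at p = ultrafilter_at q \<longleftrightarrow> p = q"
  by (simp add: ultrafilter_at_def filter_of_inject beta_of_inject)

text \<open>
  The points of the growth are exactly the ultrafilters finer than the Frechet filter
  \<open>sequentially\<close>; this lemma and the next are the two directions.
\<close>

lemma ultrafilter_at_le_sequentially: "ultrafilter_at p \<le> sequentially"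
proof -
  have "eventually (\<lambda>m. m \<noteq> n) (ultrafilter_at p)" for n
  proof -
    have "beta_of p \<notin> beta_basic {n}"
      using beta_of[of p] by (auto simp: beta_basic_singleton)
    then show ?thesis
      using is_ultrafilter_not_iff[OF ultrafilter_filter_of]
      by (simp add: beta_basic_def ultrafilter_at_def)
  qed
  then have "eventually (\<lambda>m. \<forall>n\<in>{..<N}. m \<noteq> n) (ultrafilter_at p)" for N
    by (intro eventually_ball_finite) auto
  then have "eventually (\<lambda>m. N \<le> m) (ultrafilter_at p)" for N
    by (rule eventually_mono[of "\<lambda>m. \<forall>n\<in>{..<N}. m \<noteq> n"]) (use linorder_not_le in auto)
  then show ?thesis
    unfolding le_filter_def eventually_sequentially by (meson eventually_mono)
qed

lemma ex_ultrafilter_at: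
  assumes "is_ultrafilter U" "U \<le> sequentially"
  obtains p where "ultrafilter_at p = U"
proof
  have "Beta_nat U \<notin> range nat_point"
  proof
    assume "Beta_nat U \<in> range nat_point"
    then obtain n where "Beta_nat U = nat_point n" by auto
    then have "U = principal {n}"
      using assms(1) by (metis Beta_nat_inverse filter_of_nat_point mem_Collect_eq)
    moreover have "eventually (\<lambda>m. n < m) U"
      using assms(2) eventually_gt_at_top by (auto simp: le_filter_def)
    ultimately show False
      by (simp add: eventually_principal)
  qed
  then show "ultrafilter_at (Nat_star (Beta_nat U)) = U"
    using assms(1) by (simp add: ultrafilter_at_def Nat_star_inverse Beta_nat_inverse)
qed

text \<open>
  Whatever happens infinitely often is seen by some point of the growth.
\<close>

lemma frequently_imp_ex_ultrafilter_at:
  assumes "frequently P sequentially"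
  obtains p where "eventually P (ultrafilter_at p)"
proof -
  have "inf sequentially (principal {n. P n}) \<noteq> bot"
    using assms by (auto simp: trivial_limit_def eventually_inf_principal frequently_def)
  then obtain U where U: "U \<le> inf sequentially (principal {n. P n})" "is_ultrafilter U"
    using ex_ultrafilter_le by blast
  then obtain p where "ultrafilter_at p = U"
    using ex_ultrafilter_at by auto
  with U(1) have "eventually P (ultrafilter_at p)" by (simp add: le_principal)
  with that show ?thesis .
qed

lemma open_star_basic: "open (star_basic A)"
  unfolding star_basic_eq_vimage open_nat_star_def using open_beta_basic by blast

lemma star_basic_Compl: "star_basic (- A) = - star_basic A"
  by (auto simp: star_basic_eq_vimage beta_basic_Compl)

lemma star_basic_base:
  assumes "open U" "p \<in> U"
  obtains A where "p \<in> star_basic A" "star_basic A \<subseteq> U"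
proof -
  obtain V where V: "open V" "U = beta_of -` V"
    using assms(1) by (auto simp: open_nat_star_def)
  with assms(2) obtain A where "beta_of p \<in> beta_basic A" "beta_basic A \<subseteq> V"
    by (auto simp: open_beta_nat_def)
  with V(2) that[of A] show ?thesis
    by (auto simp: star_basic_eq_vimage)
qed

lemma continuous_on_into_nat_star:
  fixes \<phi> :: "'a::topological_space \<Rightarrow> nat_star"
  assumes "\<And>A. open (\<phi> -` star_basic A)"
  shows "continuous_on UNIV \<phi>"
proof -
  have "open (\<phi> -` U)" if "open U" for U
  proof (subst open_subopen, rule ballI)
    fix x assume "x \<in> \<phi> -` U"
    with star_basic_base[OF that] obtain A where "\<phi> x \<in> star_basic A" "star_basic A \<subseteq> U"
      by (metis vimageE)
    then show "\<exists>T. open T \<and> x \<in> T \<and> T \<subseteq> \<phi> -` U"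
      using assms[of A] by blast
  qed
  then show ?thesis by (simp add: continuous_on_open_vimage)
qed

definition star_indicator :: "nat set \<Rightarrow> nat_star \<Rightarrow>\<^sub>C 'k::real_normed_field"
  where "star_indicator A = Bcontfun (indicator (star_basic A))"

lemma apply_star_indicator:
  "apply_bcontfun (star_indicator A :: nat_star \<Rightarrow>\<^sub>C 'k::real_normed_field) = indicator (star_basic A)"
proof -
  have "continuous_on UNIV (indicator (star_basic A) :: nat_star \<Rightarrow> 'k)"
    unfolding continuous_on_open_vimage[OF open_UNIV]
  proof (intro allI impI)
    fix B :: "'k set"
    have "indicator (star_basic A) -` B =
        (if 1 \<in> B then star_basic A else {}) \<union> (if 0 \<in> B then star_basic (- A) else {})"
      by (auto simp: indicator_def of_bool_def star_basic_Compl split: if_splits)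
    then show "open (indicator (star_basic A) -` B \<inter> UNIV)"
      by (simp add: open_Un open_star_basic)
  qed
  then show ?thesis
    unfolding star_indicator_def by (intro Bcontfun_inverse continuous_nat_star_bcontfun)
qed


section \<open>Composition operators and endomorphisms\<close>

text \<open>
  \<open>composition_operator \<phi>\<close> has its intended meaning only for continuous \<open>\<phi>\<close>;
  otherwise \<open>f \<circ> \<phi>\<close> may lie outside the domain of \<open>Bcontfun\<close>.
\<close>

definition composition_operator ::
    "(nat_star \<Rightarrow> nat_star) \<Rightarrow> (nat_star \<Rightarrow>\<^sub>C 'k::metric_space) \<Rightarrow> (nat_star \<Rightarrow>\<^sub>C 'k)"
  where "composition_operator \<phi> f = Bcontfun (\<lambda>p. f (\<phi> p))"

lemma apply_composition_operator:
  assumes "continuous_on UNIV \<phi>"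
  shows "apply_bcontfun (composition_operator \<phi> f) p = f (\<phi> p)"
proof -
  have "continuous_on UNIV (\<lambda>p. f (\<phi> p))"
    using continuous_on_compose2[OF continuous_on_apply_bcontfun assms] by auto
  then show ?thesis
    unfolding composition_operator_def
    by (subst Bcontfun_inverse) (auto intro: continuous_nat_star_bcontfun)
qed

lemma composition_operator_endomorphism:
  fixes \<phi> :: "nat_star \<Rightarrow> nat_star"
  assumes "continuous_on UNIV \<phi>"
  shows "algebra_endomorphism scale_bcontfun
    (composition_operator \<phi> :: (nat_star \<Rightarrow>\<^sub>C 'k::{real_normed_field, banach}) \<Rightarrow> _)"
  unfolding algebra_endomorphism_def Vector_Spaces.linear_iff
  by (intro conjI allI vector_space_scale_bcontfun bcontfun_eqI)
    (simp_all add: apply_composition_operator[OF assms])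

lemma norm_composition_operator:
  fixes f :: "nat_star \<Rightarrow>\<^sub>C 'k::real_normed_vector"
  assumes "continuous_on UNIV \<phi>" "surj \<phi>"
  shows "norm (composition_operator \<phi> f) = norm f"
proof (rule antisym)
  show "norm (composition_operator \<phi> f) \<le> norm f"
    by (rule norm_bound) (simp add: apply_composition_operator[OF assms(1)] norm_bounded)
  show "norm f \<le> norm (composition_operator \<phi> f)"
  proof (rule norm_bound)
    fix p
    obtain q where "p = \<phi> q"
      using assms(2) by (metis surjD)
    then show "norm (apply_bcontfun f p) \<le> norm (composition_operator \<phi> f)"
      using norm_bounded[of "composition_operator \<phi> f" q]
      by (simp add: apply_composition_operator[OF assms(1)])
  qed
qed

lemma composition_operator_Iso:
  fixes \<phi> :: "nat_star \<Rightarrow> nat_star"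
  assumes "continuous_on UNIV \<phi>" "surj \<phi>"
    and "surj (composition_operator \<phi> :: (nat_star \<Rightarrow>\<^sub>C 'k::{real_normed_field, banach}) \<Rightarrow> _)"
  shows "(composition_operator \<phi> :: (nat_star \<Rightarrow>\<^sub>C 'k) \<Rightarrow> _) \<in> Iso scale_bcontfun"
  using composition_operator_endomorphism[OF assms(1), where 'k = 'k] assms
  by (simp add: Iso_def algebra_endomorphism_def norm_composition_operator)

lemma composition_operator_bounded:
  fixes \<phi> :: "nat_star \<Rightarrow> nat_star"
  assumes "continuous_on UNIV \<phi>"
  shows "(composition_operator \<phi> :: (nat_star \<Rightarrow>\<^sub>C 'k::{real_normed_field, banach}) \<Rightarrow> _)
    \<in> bounded_ops scale_bcontfun"
proof -
  have "dist (composition_operator \<phi> f) (composition_operator \<phi> g) \<le> dist f g"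
    for f g :: "nat_star \<Rightarrow>\<^sub>C 'k"
    by (rule dist_bound) (simp add: apply_composition_operator[OF assms] dist_bounded)
  then have "continuous_on UNIV (composition_operator \<phi> :: (nat_star \<Rightarrow>\<^sub>C 'k) \<Rightarrow> _)"
    by (auto simp: continuous_on_iff intro: le_less_trans)
  then show ?thesis
    using composition_operator_endomorphism[OF assms, where 'k = 'k]
    by (simp add: bounded_ops_def algebra_endomorphism_def)
qed

lemma bij_composition_operator:
  fixes \<phi> :: "nat_star \<Rightarrow> nat_star"
  assumes "continuous_on UNIV \<phi>" "continuous_on UNIV \<psi>"
    and "\<And>p. \<phi> (\<psi> p) = p" "\<And>p. \<psi> (\<phi> p) = p"
  shows "bij (composition_operator \<phi> :: (nat_star \<Rightarrow>\<^sub>C 'k::metric_space) \<Rightarrow> _)"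
proof (rule o_bij)
  show "composition_operator \<psi> \<circ> composition_operator \<phi> = (id :: (nat_star \<Rightarrow>\<^sub>C 'k) \<Rightarrow> _)"
    by (rule ext, rule bcontfun_eqI) (simp add: apply_composition_operator assms)
  show "composition_operator \<phi> \<circ> composition_operator \<psi> = (id :: (nat_star \<Rightarrow>\<^sub>C 'k) \<Rightarrow> _)"
    by (rule ext, rule bcontfun_eqI) (simp add: apply_composition_operator assms)
qed

text \<open>
  Evaluation at \<open>p\<close> after \<open>T\<close> is a character, hence evaluation at some \<open>\<phi> p\<close>. Continuity
  of \<open>\<phi>\<close> is tested on the clopen base: the preimage of a basic set is the set where the image
  under \<open>T\<close> of its indicator function is nonzero. In particular \<open>T\<close> is automatically continuous.
\<close>

theorem unital_endomorphism_is_composition: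
  fixes T :: "(nat_star \<Rightarrow>\<^sub>C 'k::{real_normed_field, banach}) \<Rightarrow> (nat_star \<Rightarrow>\<^sub>C 'k)"
  assumes T: "algebra_endomorphism scale_bcontfun T" and one: "T 1 = 1"
  obtains \<phi> where "continuous_on UNIV \<phi>" "T = composition_operator \<phi>"
proof -
  interpret Vector_Spaces.linear scale_bcontfun scale_bcontfun T
    using T by (simp add: algebra_endomorphism_def)
  have mult: "T (f * g) = T f * T g" for f g
    using T by (simp add: algebra_endomorphism_def)
  have "\<exists>q. \<forall>f. apply_bcontfun (T f) p = apply_bcontfun f q" for p
    by (rule character_is_evaluation[OF compact_nat_star, of "\<lambda>f. apply_bcontfun (T f) p"])
      (auto simp: add scale mult one)
  then obtain \<phi> where \<phi>: "\<And>p f. apply_bcontfun (T f) p = apply_bcontfun f (\<phi> p)"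
    by metis
  have "continuous_on UNIV \<phi>"
  proof (rule continuous_on_into_nat_star)
    fix A
    have "\<phi> -` star_basic A = {p. apply_bcontfun (T (star_indicator A)) p \<noteq> 0}"
      by (auto simp: \<phi> apply_star_indicator indicator_def)
    also have "open \<dots>"
      by (intro open_Collect_neq continuous_intros) auto
    finally show "open (\<phi> -` star_basic A)" .
  qed
  moreover from this have "T = composition_operator \<phi>"
    by (intro ext bcontfun_eqI) (simp add: \<phi> apply_composition_operator)
  ultimately show ?thesis using that by blast
qed

text \<open>
  The range of \<open>\<phi>\<close> is closed, so if it misses a point, it misses a basic clopen set, whose
  indicator function then composes with \<open>\<phi>\<close> to \<open>0\<close>.
\<close>

lemma inj_composition_operator_imp_surj:
  fixes \<phi> :: "nat_star \<Rightarrow> nat_star"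
  assumes "continuous_on UNIV \<phi>"
    and inj: "inj (composition_operator \<phi> :: (nat_star \<Rightarrow>\<^sub>C 'k::real_normed_field) \<Rightarrow> _)"
  shows "surj \<phi>"
proof (rule ccontr)
  assume "\<not> surj \<phi>"
  then obtain q where q: "q \<in> - range \<phi>" by auto
  have "open (- range \<phi>)"
    using compact_continuous_image[OF assms(1) compact_nat_star] compact_imp_closed
    by (simp add: closed_open)
  then obtain A where A: "q \<in> star_basic A" "star_basic A \<subseteq> - range \<phi>"
    using star_basic_base q by blast
  have "composition_operator \<phi> (star_indicator A) = (composition_operator \<phi> 0 :: nat_star \<Rightarrow>\<^sub>C 'k)"
    by (rule bcontfun_eqI)
      (use A(2) in \<open>auto simp: apply_composition_operator[OF assms(1)] apply_star_indicator indicator_def\<close>)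
  with inj have "(star_indicator A :: nat_star \<Rightarrow>\<^sub>C 'k) = 0"
    by (simp add: inj_eq)
  then have "apply_bcontfun (star_indicator A :: nat_star \<Rightarrow>\<^sub>C 'k) q = 0" by simp
  with A(1) show False by (simp add: apply_star_indicator)
qed


section \<open>Maps of the growth induced by maps of the natural numbers\<close>

text \<open>
  The image of a free ultrafilter is again free only if \<open>\<sigma>\<close> tends to infinity, i.e. is
  finite-to-one. For other \<open>\<sigma>\<close> the point described need not exist and the value is arbitrary.
\<close>

definition star_map :: "(nat \<Rightarrow> nat) \<Rightarrow> nat_star \<Rightarrow> nat_star"
  where "star_map \<sigma> p = (THE q. ultrafilter_at q = filtermap \<sigma> (ultrafilter_at p))"

lemma is_ultrafilter_filtermap:
  assumes "is_ultrafilter U"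
  shows "is_ultrafilter (filtermap \<sigma> U)"
  using assms by (auto simp: is_ultrafilter_def filtermap_bot_iff eventually_filtermap)

lemma ultrafilter_at_star_map:
  assumes "filterlim \<sigma> sequentially sequentially"
  shows "ultrafilter_at (star_map \<sigma> p) = filtermap \<sigma> (ultrafilter_at p)"
proof -
  have "filtermap \<sigma> (ultrafilter_at p) \<le> sequentially"
    using assms ultrafilter_at_le_sequentially filtermap_mono unfolding filterlim_def
    by (meson order_trans)
  then obtain q where *: "ultrafilter_at q = filtermap \<sigma> (ultrafilter_at p)"
    using ex_ultrafilter_at[OF is_ultrafilter_filtermap[OF is_ultrafilter_ultrafilter_at]] by blast
  then show ?thesis
    unfolding star_map_def by (rule theI) (simp flip: ultrafilter_at_inject add: *)
qed

lemma vimage_star_map: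
  assumes "filterlim \<sigma> sequentially sequentially"
  shows "star_map \<sigma> -` star_basic A = star_basic (\<sigma> -` A)"
  by (auto simp: star_basic_def ultrafilter_at_star_map[OF assms] eventually_filtermap)

lemma continuous_star_map:
  assumes "filterlim \<sigma> sequentially sequentially"
  shows "continuous_on UNIV (star_map \<sigma>)"
  by (rule continuous_on_into_nat_star) (simp add: vimage_star_map[OF assms] open_star_basic)

lemma star_map_comp_id:
  assumes "filterlim \<sigma> sequentially sequentially" "filterlim \<tau> sequentially sequentially"
    and "\<And>n. \<sigma> (\<tau> n) = n"
  shows "star_map \<sigma> (star_map \<tau> p) = p"
  unfolding ultrafilter_at_inject[symmetric]
  by (simp add: ultrafilter_at_star_map assms filtermap_filtermap filtermap_ident)

lemma filterlim_inj_sequentially: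
  fixes \<sigma> :: "nat \<Rightarrow> nat"
  assumes "inj \<sigma>"
  shows "filterlim \<sigma> sequentially sequentially"
  unfolding filterlim_iff cofinite_eq_sequentially[symmetric] eventually_cofinite
proof (intro allI impI)
  fix P :: "nat \<Rightarrow> bool"
  assume "finite {n. \<not> P n}"
  from finite_vimageI[OF this assms] show "finite {n. \<not> P (\<sigma> n)}"
    by (simp add: vimage_def)
qed



section \<open>Sequences and permutations\<close>

text \<open>
  The approximants \<open>a n\<close> of \<open>x n\<close> are cluster points of \<open>y\<close>, so the terms of \<open>y\<close> chosen close to
  them can be taken with strictly increasing indices.
\<close>

lemma asymptotic_injection:
  fixes x y :: "nat \<Rightarrow> 'a::metric_space"
  assumes a: "(\<lambda>n. dist (x n) (a n)) \<longlonglongrightarrow> 0"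
    and freq: "\<And>n e. e > 0 \<Longrightarrow> frequently (\<lambda>m. dist (y m) (a n) < e) sequentially"
  obtains F :: "nat \<Rightarrow> nat" where "strict_mono F" "(\<lambda>n. dist (x n) (y (F n))) \<longlonglongrightarrow> 0"
proof -
  have "\<exists>F. \<forall>n. dist (y (F n)) (a n) < inverse (real (Suc n)) \<and> F n < F (Suc n)"
  proof (rule dependent_nat_choice)
    show "\<exists>m. dist (y m) (a 0) < inverse (real (Suc 0))"
      using freq[of "inverse (real (Suc 0))" 0] frequently_ex by force
    fix k n
    have "frequently (\<lambda>m. dist (y m) (a (Suc n)) < inverse (real (Suc (Suc n)))) sequentially"
      by (rule freq) simp
    then show "\<exists>m. dist (y m) (a (Suc n)) < inverse (real (Suc (Suc n))) \<and> k < m"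
      unfolding frequently_sequentially by (meson Suc_le_eq)
  qed
  then obtain F where F: "\<And>n. dist (y (F n)) (a n) < inverse (real (Suc n))" "\<And>n. F n < F (Suc n)"
    by blast
  have "(\<lambda>n. dist (x n) (y (F n))) \<longlonglongrightarrow> 0"
  proof (rule tendsto_sandwich[OF _ _ tendsto_const])
    show "\<forall>\<^sub>F n in sequentially. dist (x n) (y (F n)) \<le> dist (x n) (a n) + inverse (real (Suc n))"
    proof (rule always_eventually, rule allI)
      fix n
      show "dist (x n) (y (F n)) \<le> dist (x n) (a n) + inverse (real (Suc n))"
        using dist_triangle2[of "x n" "y (F n)" "a n"] F(1)[of n] by linarith
    qed
    show "(\<lambda>n. dist (x n) (a n) + inverse (real (Suc n))) \<longlonglongrightarrow> 0"
      using tendsto_add[OF a LIMSEQ_inverse_real_of_nat] by simp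
  qed auto
  moreover have "strict_mono F"
    using F(2) by (simp add: strict_mono_Suc_iff)
  ultimately show ?thesis using that by blast
qed

text \<open>
  The Schroeder--Bernstein theorem in the form that records where the bijection comes from: its
  graph lies in the union of the graph of \<open>f\<close> and the converse of the graph of \<open>g\<close>. This is what
  lets it inherit an approximation property of \<open>f\<close> and \<open>g\<close>.
\<close>

lemma ex_bij_subset_injections:
  assumes "inj f" "inj g"
  obtains h where "bij h" "\<And>a. h a = f a \<or> g (h a) = a"
proof -
  \<comment> \<open>\<open>X\<close> is the set where \<open>f\<close> is followed; outside of it the values of \<open>g\<close> are inverted.\<close>
  define X where "X = lfp (\<lambda>X. - (g ` (- f ` X)))"
  have X: "X = - (g ` (- f ` X))"
    unfolding X_def by (rule lfp_unfold) (blast intro: monoI)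
  define h where "h a = (if a \<in> X then f a else inv g a)" for a
  have out: "\<exists>b. b \<notin> f ` X \<and> a = g b" if "a \<notin> X" for a
    using X that by blast
  have in_X: "h a \<in> f ` X" if "a \<in> X" for a
    using that by (simp add: h_def)
  have gh: "g (h a) = a" "h a \<notin> f ` X" if "a \<notin> X" for a
    using out[OF that] that assms(2) by (auto simp: h_def)
  have "inj h"
  proof (rule injI)
    fix a b assume "h a = h b"
    then consider "a \<in> X" "b \<in> X" | "a \<notin> X" "b \<notin> X"
      using in_X gh(2) by metis
    then show "a = b"
    proof cases
      case 1
      with \<open>h a = h b\<close> assms(1) show ?thesis by (simp add: h_def inj_eq)
    next
      case 2
      with \<open>h a = h b\<close> gh(1) show ?thesis by metis
    qed
  qed
  moreover have "\<exists>a. b = h a" for b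
  proof (cases "b \<in> f ` X")
    case True
    then show ?thesis by (auto simp: h_def)
  next
    case False
    then have "g b \<notin> X" using X by blast
    then show ?thesis using assms(2) by (auto simp: h_def intro!: exI[of _ "g b"])
  qed
  ultimately have "bij h" by (simp add: bij_def surj_def)
  moreover have "h a = f a \<or> g (h a) = a" for a
    using gh(1)[of a] by (cases "a \<in> X") (auto simp: h_def)
  ultimately show ?thesis using that by blast
qed

text \<open>
  For each \<open>n\<close> the pair \<open>(n, \<sigma> n)\<close> is matched either by \<open>F\<close> or by \<open>G\<close>. In the second case the
  error is the error of \<open>G\<close> at \<open>\<sigma> n\<close>, which is small for large \<open>n\<close> since \<open>\<sigma> n\<close>
  tends to infinity, \<open>\<sigma>\<close> being injective.
\<close>

lemma asymptotic_permutation: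
  fixes x y :: "nat \<Rightarrow> 'a::metric_space"
  assumes F: "inj F" "(\<lambda>n. dist (x n) (y (F n))) \<longlonglongrightarrow> 0"
    and G: "inj G" "(\<lambda>n. dist (y n) (x (G n))) \<longlonglongrightarrow> 0"
  obtains \<sigma> :: "nat \<Rightarrow> nat" where "bij \<sigma>" "(\<lambda>n. dist (x n) (y (\<sigma> n))) \<longlonglongrightarrow> 0"
proof -
  obtain \<sigma> where \<sigma>: "bij \<sigma>" "\<And>n. \<sigma> n = F n \<or> G (\<sigma> n) = n"
    using ex_bij_subset_injections[OF F(1) G(1)] by blast
  have "filterlim \<sigma> sequentially sequentially"
    using \<sigma>(1) by (simp add: filterlim_inj_sequentially bij_is_inj)
  from filterlim_compose[OF G(2) this]
  have "(\<lambda>n. dist (y (\<sigma> n)) (x (G (\<sigma> n)))) \<longlonglongrightarrow> 0" .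
  from tendsto_add[OF F(2) this]
  have lim: "(\<lambda>n. dist (x n) (y (F n)) + dist (y (\<sigma> n)) (x (G (\<sigma> n)))) \<longlonglongrightarrow> 0" by simp
  have "dist (x n) (y (\<sigma> n)) \<le> dist (x n) (y (F n)) + dist (y (\<sigma> n)) (x (G (\<sigma> n)))" for n
    using \<sigma>(2)[of n] by (auto simp: dist_commute)
  then have "(\<lambda>n. dist (x n) (y (\<sigma> n))) \<longlonglongrightarrow> 0"
    by (intro tendsto_sandwich[OF _ _ tendsto_const lim]) auto
  with \<sigma>(1) that show ?thesis by blast
qed


section \<open>Continuous functions on the growth as sequences\<close>

text \<open>
  The sequence \<open>x\<close> on \<open>\<nat>\<close> and the function \<open>f\<close> on the growth fit together to a function
  on \<open>\<beta>\<nat>\<close> that is continuous at the points of the growth.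
\<close>

definition boundary_values :: "(nat \<Rightarrow> 'a::metric_space) \<Rightarrow> (nat_star \<Rightarrow> 'a) \<Rightarrow> bool"
  where "boundary_values x f \<longleftrightarrow> (\<forall>p. (x \<longlongrightarrow> f p) (ultrafilter_at p))"

lemma boundary_valuesD: "boundary_values x f \<Longrightarrow> (x \<longlongrightarrow> f p) (ultrafilter_at p)"
  by (simp add: boundary_values_def)

lemma continuous_imp_tendsto_nat_point:
  fixes g :: "beta_nat \<Rightarrow> 'a::topological_space"
  assumes "continuous_on UNIV g"
  shows "((\<lambda>n. g (nat_point n)) \<longlongrightarrow> g p) (filter_of p)"
proof (rule topological_tendstoI)
  fix S assume "open S" "g p \<in> S"
  then have "open (g -` S)" "p \<in> g -` S"
    using assms by (auto simp: continuous_on_open_vimage)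
  then obtain A where A: "p \<in> beta_basic A" "beta_basic A \<subseteq> g -` S"
    by (meson open_beta_nat_def)
  have "eventually (\<lambda>n. n \<in> A) (filter_of p)"
    using A(1) by (simp add: beta_basic_def)
  then show "eventually (\<lambda>n. g (nat_point n) \<in> S) (filter_of p)"
    by (rule eventually_mono) (use A(2) in \<open>auto simp: subset_iff\<close>)
qed

text \<open>
  The growth is closed in the compact Hausdorff, hence normal, space \<open>\<beta>\<nat>\<close>. The sequence is the
  restriction to \<open>\<nat>\<close> of a Tietze extension.
\<close>

lemma ex_boundary_sequence_real:
  fixes f :: "nat_star \<Rightarrow> real"
  assumes "continuous_on UNIV f"
  shows "\<exists>x. boundary_values x f"
proof -
  let ?S = "UNIV - range nat_point"
  have Nat_star: "beta_of (Nat_star q) = q" if "q \<in> ?S" for q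
    using that by (simp add: Nat_star_inverse)
  have normal: "normal_space (euclidean :: beta_nat topology)"
  proof (rule compact_Hausdorff_or_regular_imp_normal_space)
    have "Hausdorff_space (euclidean :: beta_nat topology)"
      unfolding Hausdorff_space_def disjnt_def by (metis hausdorff open_openin)
    then show "Hausdorff_space (euclidean :: beta_nat topology) \<or> regular_space euclidean" ..
  qed (simp add: compact_space_def compact_beta_nat)
  have "open (\<Union>n. {nat_point n})"
    by (intro open_UN ballI open_nat_point)
  then have closed: "closed ?S"
    by (simp add: UNION_singleton_eq_range closed_def Compl_eq_Diff_UNIV[symmetric])
  have "continuous_on ?S (\<lambda>q. f (Nat_star q))"
    unfolding continuous_on_open_invariant
  proof (intro allI impI)
    fix B :: "real set" assume "open B"
    then have "open (f -` B)"
      using assms by (simp add: continuous_on_open_vimage)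
    then obtain V where V: "open V" "f -` B = beta_of -` V"
      by (auto simp: open_nat_star_def)
    have "f (Nat_star q) \<in> B \<longleftrightarrow> q \<in> V" if "q \<in> ?S" for q
      using V(2) Nat_star[OF that] by (metis vimage_eq)
    then have "V \<inter> ?S = (\<lambda>q. f (Nat_star q)) -` B \<inter> ?S"
      by blast
    with V(1) show "\<exists>A. open A \<and> A \<inter> ?S = (\<lambda>q. f (Nat_star q)) -` B \<inter> ?S"
      by blast
  qed
  then obtain g where g: "continuous_on UNIV g" "\<And>q. q \<in> ?S \<Longrightarrow> g q = f (Nat_star q)"
    using Tietze_extension_realinterval[OF normal, of ?S UNIV "\<lambda>q. f (Nat_star q)"] closed
    by auto
  have "((\<lambda>n. g (nat_point n)) \<longlongrightarrow> f p) (ultrafilter_at p)" for p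
    using continuous_imp_tendsto_nat_point[OF g(1), of "beta_of p"] g(2)[OF beta_of]
    by (simp add: ultrafilter_at_def beta_of_inverse)
  then show ?thesis
    unfolding boundary_values_def by blast
qed

lemma ex_boundary_sequence:
  fixes f :: "nat_star \<Rightarrow> 'a::euclidean_space"
  assumes "continuous_on UNIV f"
  shows "\<exists>x. boundary_values x f"
proof -
  have "\<exists>x. boundary_values x (\<lambda>p. f p \<bullet> b)" for b
    by (intro ex_boundary_sequence_real continuous_intros assms)
  then obtain x where x: "\<And>b. boundary_values (x b) (\<lambda>p. f p \<bullet> b)"
    by metis
  have "((\<lambda>n. \<Sum>b\<in>Basis. x b n *\<^sub>R b) \<longlongrightarrow> (\<Sum>b\<in>Basis. (f p \<bullet> b) *\<^sub>R b)) (ultrafilter_at p)" for p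
    by (intro tendsto_intros boundary_valuesD[OF x])
  then show ?thesis
    unfolding boundary_values_def by (auto simp: euclidean_representation)
qed

lemma boundary_value_is_cluster_point:
  assumes "boundary_values x f" "e > 0"
  shows "frequently (\<lambda>n. dist (x n) (f p) < e) sequentially"
proof -
  have "eventually (\<lambda>n. dist (x n) (f p) < e) (ultrafilter_at p)"
    using tendstoD[OF boundary_valuesD[OF assms(1)] assms(2)] .
  then have "frequently (\<lambda>n. dist (x n) (f p) < e) (ultrafilter_at p)"
    by (rule eventually_frequently[OF ultrafilter_at_neq_bot])
  then show ?thesis
    using ultrafilter_at_le_sequentially unfolding frequently_def le_filter_def by blast
qed

text \<open>
  If infinitely many terms stayed away from the range of \<open>f\<close>, some point \<open>p\<close> of the growth would
  see only such terms, although \<open>x\<close> tends to \<open>f p\<close> along \<open>p\<close>.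
\<close>

lemma boundary_sequence_approaches_range:
  fixes x :: "nat \<Rightarrow> 'a::heine_borel"
  assumes "boundary_values x f" "continuous_on UNIV f"
  obtains a where "range a \<subseteq> range f" "(\<lambda>n. dist (x n) (a n)) \<longlonglongrightarrow> 0"
proof -
  have "closed (range f)"
    using compact_continuous_image[OF assms(2) compact_nat_star] by (rule compact_imp_closed)
  then have "\<exists>a. a \<in> range f \<and> infdist (x n) (range f) = dist (x n) a" for n
    using infdist_attains_inf[of "range f" "x n"] by (metis UNIV_not_empty image_is_empty)
  then obtain a where a: "\<And>n. a n \<in> range f" "\<And>n. infdist (x n) (range f) = dist (x n) (a n)"
    by metis
  have "(\<lambda>n. infdist (x n) (range f)) \<longlonglongrightarrow> 0"
  proof (rule tendstoI, rule ccontr)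
    fix e :: real assume e: "e > 0"
    assume "\<not> (\<forall>\<^sub>F n in sequentially. dist (infdist (x n) (range f)) 0 < e)"
    then have "frequently (\<lambda>n. e \<le> infdist (x n) (range f)) sequentially"
      by (simp add: frequently_def not_le infdist_nonneg)
    then obtain p where "eventually (\<lambda>n. e \<le> infdist (x n) (range f)) (ultrafilter_at p)"
      using frequently_imp_ex_ultrafilter_at by blast
    moreover have "eventually (\<lambda>n. dist (x n) (f p) < e) (ultrafilter_at p)"
      using tendstoD[OF boundary_valuesD[OF assms(1)] e] .
    ultimately have "eventually (\<lambda>n. False) (ultrafilter_at p)"
    proof eventually_elim
      case (elim n)
      have "infdist (x n) (range f) \<le> dist (x n) (f p)"
        by (rule infdist_le) simp
      with elim show ?case by simp
    qed
    then show False
      using ultrafilter_at_neq_bot by (simp add: trivial_limit_def)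
  qed
  with a that show ?thesis by (auto simp: image_subset_iff)
qed

text \<open>
  The nearest points \<open>a\<close> of \<open>x\<close> in the common range are values of \<open>g\<close> and hence cluster points of
  \<open>y\<close>; symmetrically for \<open>b\<close>. This yields the two injections, and their merger \<open>\<sigma>\<close>. Along an
  ultrafilter \<open>p\<close>, the sequences \<open>y\<close> and \<open>x \<circ> \<sigma>\<close> have the same limit, which is \<open>g p\<close> for the
  first and the value of \<open>f\<close> at the image of \<open>p\<close> for the second.
\<close>

theorem same_range_imp_permutation:
  fixes f g :: "nat_star \<Rightarrow> 'a::euclidean_space"
  assumes f: "continuous_on UNIV f" and g: "continuous_on UNIV g" and range: "range f = range g"
  obtains \<sigma> where "bij \<sigma>" "\<And>p. g p = f (star_map \<sigma> p)"
proof -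
  obtain x y where x: "boundary_values x f" and y: "boundary_values y g"
    using ex_boundary_sequence f g by meson
  obtain a where a: "range a \<subseteq> range f" "(\<lambda>n. dist (x n) (a n)) \<longlonglongrightarrow> 0"
    using boundary_sequence_approaches_range[OF x f] .
  obtain b where b: "range b \<subseteq> range g" "(\<lambda>n. dist (y n) (b n)) \<longlonglongrightarrow> 0"
    using boundary_sequence_approaches_range[OF y g] .
  have "a n \<in> range g" "b n \<in> range f" for n
    using a(1) b(1) range by blast+
  then have "\<exists>p. a n = g p" "\<exists>p. b n = f p" for n
    by blast+
  then have fa: "frequently (\<lambda>m. dist (y m) (a n) < e) sequentially"
    and fb: "frequently (\<lambda>m. dist (x m) (b n) < e) sequentially" if "e > 0" for n e
    using boundary_value_is_cluster_point[OF x that] boundary_value_is_cluster_point[OF y that]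
    by metis+
  obtain F where F: "strict_mono F" "(\<lambda>n. dist (x n) (y (F n))) \<longlonglongrightarrow> 0"
    using asymptotic_injection[OF a(2) fa] by blast
  obtain G where G: "strict_mono G" "(\<lambda>n. dist (y n) (x (G n))) \<longlonglongrightarrow> 0"
    using asymptotic_injection[OF b(2) fb] by blast
  obtain \<sigma> where \<sigma>: "bij \<sigma>" "(\<lambda>n. dist (y n) (x (\<sigma> n))) \<longlonglongrightarrow> 0"
    using asymptotic_permutation[OF strict_mono_imp_inj_on[OF G(1)] G(2)
        strict_mono_imp_inj_on[OF F(1)] F(2)] by blast
  have \<sigma>_lim: "filterlim \<sigma> sequentially sequentially"
    using \<sigma>(1) by (simp add: filterlim_inj_sequentially bij_is_inj)
  have "g p = f (star_map \<sigma> p)" for p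
  proof (rule tendsto_unique[OF ultrafilter_at_neq_bot])
    show "(y \<longlongrightarrow> g p) (ultrafilter_at p)"
      by (rule boundary_valuesD[OF y])
    have "((\<lambda>n. x (\<sigma> n)) \<longlongrightarrow> f (star_map \<sigma> p)) (ultrafilter_at p)"
      using boundary_valuesD[OF x, of "star_map \<sigma> p"]
      by (simp add: ultrafilter_at_star_map[OF \<sigma>_lim] filterlim_filtermap)
    moreover have "((\<lambda>n. dist (y n) (x (\<sigma> n))) \<longlongrightarrow> 0) (ultrafilter_at p)"
      using \<sigma>(2) ultrafilter_at_le_sequentially by (rule tendsto_mono[rotated])
    ultimately show "(y \<longlongrightarrow> f (star_map \<sigma> p)) (ultrafilter_at p)"
      unfolding dist_norm by (rule Lim_transform[OF _ tendsto_norm_zero_cancel])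
  qed
  with \<sigma>(1) that show ?thesis by blast
qed


section \<open>Failure of algebraic reflexivity\<close>

lemma composition_operator_permutation:
  fixes \<sigma> :: "nat \<Rightarrow> nat"
  assumes "bij \<sigma>"
  shows "(composition_operator (star_map \<sigma>) :: (nat_star \<Rightarrow>\<^sub>C 'k::{real_normed_field, banach}) \<Rightarrow> _)
    \<in> Aut scale_bcontfun \<inter> Iso scale_bcontfun"
proof -
  define \<tau> where "\<tau> = inv \<sigma>"
  have lim: "filterlim \<sigma> sequentially sequentially" "filterlim \<tau> sequentially sequentially"
    using assms bij_imp_bij_inv[OF assms]
    by (simp_all add: \<tau>_def filterlim_inj_sequentially bij_is_inj)
  have inv: "\<sigma> (\<tau> n) = n" "\<tau> (\<sigma> n) = n" for n
    using assms by (simp_all add: \<tau>_def bij_is_inj bij_is_surj surj_f_inv_f)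
  note cont = continuous_star_map[OF lim(1)] continuous_star_map[OF lim(2)]
  note star_inv = star_map_comp_id[OF lim inv(1)] star_map_comp_id[OF lim(2,1) inv(2)]
  have bij: "bij (composition_operator (star_map \<sigma>) :: (nat_star \<Rightarrow>\<^sub>C 'k) \<Rightarrow> _)"
    by (rule bij_composition_operator[OF cont star_inv])
  have "surj (star_map \<sigma>)"
    using star_inv(1) by (metis surjI)
  then show ?thesis
    using composition_operator_Iso[OF cont(1), where 'k = 'k] bij
      composition_operator_endomorphism[OF cont(1), where 'k = 'k]
      composition_operator_bounded[OF cont(1), where 'k = 'k]
    by (simp add: Aut_def bounded_ops_def bij_is_surj)
qed

text \<open>
  For fixed \<open>f\<close>, surjectivity of \<open>\<phi>\<close> makes the ranges of \<open>f\<close> and \<open>f \<circ> \<phi>\<close> equal. The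
  permutation obtained from this depends on \<open>f\<close>.
\<close>

theorem surjective_composition_is_locally_permutation:
  fixes \<phi> :: "nat_star \<Rightarrow> nat_star"
  assumes "continuous_on UNIV \<phi>" "surj \<phi>"
  shows "(composition_operator \<phi> :: (nat_star \<Rightarrow>\<^sub>C 'k::{real_normed_field, euclidean_space}) \<Rightarrow> _)
    \<in> ref_al scale_bcontfun (Aut scale_bcontfun \<inter> Iso scale_bcontfun)"
proof -
  have "\<exists>L\<in>Aut scale_bcontfun \<inter> Iso scale_bcontfun. composition_operator \<phi> f = L f"
    for f :: "nat_star \<Rightarrow>\<^sub>C 'k"
  proof -
    have "continuous_on UNIV (\<lambda>p. apply_bcontfun f (\<phi> p))"
      using continuous_on_compose2[OF continuous_on_apply_bcontfun assms(1)] by auto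
    moreover have "range (apply_bcontfun f) = range (\<lambda>p. apply_bcontfun f (\<phi> p))"
      using assms(2) by (metis image_image)
    ultimately obtain \<sigma> where \<sigma>: "bij \<sigma>"
      "\<And>p. apply_bcontfun f (\<phi> p) = apply_bcontfun f (star_map \<sigma> p)"
      using same_range_imp_permutation[of "apply_bcontfun f" "\<lambda>p. apply_bcontfun f (\<phi> p)"]
      by auto
    have "continuous_on UNIV (star_map \<sigma>)"
      using \<sigma>(1) by (simp add: continuous_star_map filterlim_inj_sequentially bij_is_inj)
    then have "composition_operator \<phi> f = composition_operator (star_map \<sigma>) f"
      by (intro bcontfun_eqI) (simp add: apply_composition_operator assms(1) \<sigma>(2))
    with composition_operator_permutation[OF \<sigma>(1)] show ?thesis by blast
  qed
  then show ?thesis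
    using composition_operator_bounded[OF assms(1), where 'k = 'k] by (simp add: ref_al_def)
qed

lemma ref_al_mono: "S \<subseteq> S' \<Longrightarrow> ref_al s S \<subseteq> ref_al s S'"
  unfolding ref_al_def by blast

theorem unital_injective_endomorphism_in_ref_al_Aut:
  fixes T :: "(nat_star \<Rightarrow>\<^sub>C 'k::{real_normed_field, euclidean_space}) \<Rightarrow> (nat_star \<Rightarrow>\<^sub>C 'k)"
  assumes "algebra_endomorphism scale_bcontfun T" "T 1 = 1" "inj T"
  shows "T \<in> ref_al scale_bcontfun (Aut scale_bcontfun)"
proof -
  obtain \<phi> where \<phi>: "continuous_on UNIV \<phi>" "T = composition_operator \<phi>"
    using unital_endomorphism_is_composition[OF assms(1,2)] .
  then have "surj \<phi>"
    using inj_composition_operator_imp_surj assms(3) by blast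
  then show ?thesis
    using surjective_composition_is_locally_permutation[OF \<phi>(1)] ref_al_mono[of _ "Aut scale_bcontfun"]
    unfolding \<phi>(2) by blast
qed

text \<open>
  Halving has two right inverses with disjoint images, doubling and its successor. Everything in
  the range of the composition operator takes equal values at the two images of a point, unlike
  the indicator function of the even numbers.
\<close>

theorem ex_nonsurjective_local_automorphism:
  obtains T :: "(nat_star \<Rightarrow>\<^sub>C 'k::{real_normed_field, euclidean_space}) \<Rightarrow> (nat_star \<Rightarrow>\<^sub>C 'k)"
  where "T \<in> ref_al scale_bcontfun (Aut scale_bcontfun \<inter> Iso scale_bcontfun)" "\<not> surj T"
proof
  define \<delta> :: "nat \<Rightarrow> nat" where "\<delta> n = n div 2" for n
  define \<epsilon> :: "nat \<Rightarrow> nat" where "\<epsilon> n = 2 * n" for n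
  define \<epsilon>' :: "nat \<Rightarrow> nat" where "\<epsilon>' n = 2 * n + 1" for n
  have inverse: "\<delta> (\<epsilon> n) = n" "\<delta> (\<epsilon>' n) = n" for n
    by (simp_all add: \<delta>_def \<epsilon>_def \<epsilon>'_def)
  have \<delta>: "filterlim \<delta> sequentially sequentially"
    unfolding filterlim_at_top eventually_sequentially \<delta>_def
    by (metis div_le_mono nonzero_mult_div_cancel_left zero_neq_numeral)
  have "inj \<epsilon>" "inj \<epsilon>'"
    by (simp_all add: inj_def \<epsilon>_def \<epsilon>'_def)
  then have \<epsilon>: "filterlim \<epsilon> sequentially sequentially" and \<epsilon>': "filterlim \<epsilon>' sequentially sequentially"
    by (simp_all add: filterlim_inj_sequentially)
  note cont = continuous_star_map[OF \<delta>]
  have section1: "star_map \<delta> (star_map \<epsilon> p) = p" for p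
    by (rule star_map_comp_id[OF \<delta> \<epsilon> inverse(1)])
  have section2: "star_map \<delta> (star_map \<epsilon>' p) = p" for p
    by (rule star_map_comp_id[OF \<delta> \<epsilon>' inverse(2)])
  have surj_star_map: "surj (star_map \<delta>)"
    using section1 by (metis surjI)
  let ?T = "composition_operator (star_map \<delta>) :: (nat_star \<Rightarrow>\<^sub>C 'k) \<Rightarrow> _"
  show "?T \<in> ref_al scale_bcontfun (Aut scale_bcontfun \<inter> Iso scale_bcontfun)"
    by (rule surjective_composition_is_locally_permutation[OF cont surj_star_map])
  show "\<not> surj ?T"
  proof
    assume "surj ?T"
    then obtain f where f: "star_indicator {n. even n} = ?T f"
      by (metis surjD)
    obtain p :: nat_star where True by blast
    have "star_map \<epsilon> p \<in> star_basic {n. even n}" "star_map \<epsilon>' p \<notin> star_basic {n. even n}"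
      using ultrafilter_at_neq_bot[of p]
      by (simp_all add: star_basic_def ultrafilter_at_star_map \<epsilon> \<epsilon>' eventually_filtermap \<epsilon>_def \<epsilon>'_def)
    moreover have "apply_bcontfun (?T f) (star_map \<epsilon> p) = apply_bcontfun (?T f) (star_map \<epsilon>' p)"
      by (simp add: apply_composition_operator[OF cont] section1 section2)
    ultimately show False
      unfolding f[symmetric] by (simp add: apply_star_indicator)
  qed
qed

theorem Aut_not_algebraically_reflexive:
  "\<not> algebraically_reflexive scale_bcontfun
    (Aut scale_bcontfun :: ((nat_star \<Rightarrow>\<^sub>C 'k::{real_normed_field, euclidean_space}) \<Rightarrow> _) set)"
proof
  assume "algebraically_reflexive scale_bcontfun (Aut scale_bcontfun :: ((nat_star \<Rightarrow>\<^sub>C 'k) \<Rightarrow> _) set)"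
  then have "ref_al scale_bcontfun (Aut scale_bcontfun \<inter> Iso scale_bcontfun)
      \<subseteq> (Aut scale_bcontfun :: ((nat_star \<Rightarrow>\<^sub>C 'k) \<Rightarrow> _) set)"
    unfolding algebraically_reflexive_def by (metis inf_le1 ref_al_mono)
  moreover obtain T :: "(nat_star \<Rightarrow>\<^sub>C 'k) \<Rightarrow> (nat_star \<Rightarrow>\<^sub>C 'k)"
    where "T \<in> ref_al scale_bcontfun (Aut scale_bcontfun \<inter> Iso scale_bcontfun)" "\<not> surj T"
    using ex_nonsurjective_local_automorphism .
  ultimately show False by (auto simp: Aut_def bij_is_surj)
qed

theorem Iso_not_algebraically_reflexive:
  "\<not> algebraically_reflexive scale_bcontfun
    (Iso scale_bcontfun :: ((nat_star \<Rightarrow>\<^sub>C 'k::{real_normed_field, euclidean_space}) \<Rightarrow> _) set)"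
proof
  assume "algebraically_reflexive scale_bcontfun (Iso scale_bcontfun :: ((nat_star \<Rightarrow>\<^sub>C 'k) \<Rightarrow> _) set)"
  then have "ref_al scale_bcontfun (Aut scale_bcontfun \<inter> Iso scale_bcontfun)
      \<subseteq> (Iso scale_bcontfun :: ((nat_star \<Rightarrow>\<^sub>C 'k) \<Rightarrow> _) set)"
    unfolding algebraically_reflexive_def by (metis inf_le2 ref_al_mono)
  moreover obtain T :: "(nat_star \<Rightarrow>\<^sub>C 'k) \<Rightarrow> (nat_star \<Rightarrow>\<^sub>C 'k)"
    where "T \<in> ref_al scale_bcontfun (Aut scale_bcontfun \<inter> Iso scale_bcontfun)" "\<not> surj T"
    using ex_nonsurjective_local_automorphism .
  ultimately show False by (auto simp: Iso_def)
qed

theorem theorem9: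
  shows
    "(\<forall>T :: (nat_star \<Rightarrow>\<^sub>C real) \<Rightarrow> (nat_star \<Rightarrow>\<^sub>C real).
        algebra_endomorphism scale_bcontfun T \<and> T 1 = 1 \<and> inj T
        \<longrightarrow> T \<in> ref_al scale_bcontfun (Aut scale_bcontfun)) \<and>
     \<not> algebraically_reflexive scale_bcontfun
         (Iso scale_bcontfun :: ((nat_star \<Rightarrow>\<^sub>C real) \<Rightarrow> (nat_star \<Rightarrow>\<^sub>C real)) set) \<and>
     \<not> algebraically_reflexive scale_bcontfun
         (Aut scale_bcontfun :: ((nat_star \<Rightarrow>\<^sub>C real) \<Rightarrow> (nat_star \<Rightarrow>\<^sub>C real)) set) \<and>
     (\<forall>T :: (nat_star \<Rightarrow>\<^sub>C complex) \<Rightarrow> (nat_star \<Rightarrow>\<^sub>C complex).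
        algebra_endomorphism scale_bcontfun T \<and> T 1 = 1 \<and> inj T
        \<longrightarrow> T \<in> ref_al scale_bcontfun (Aut scale_bcontfun)) \<and>
     \<not> algebraically_reflexive scale_bcontfun
         (Iso scale_bcontfun :: ((nat_star \<Rightarrow>\<^sub>C complex) \<Rightarrow> (nat_star \<Rightarrow>\<^sub>C complex)) set) \<and>
     \<not> algebraically_reflexive scale_bcontfun
         (Aut scale_bcontfun :: ((nat_star \<Rightarrow>\<^sub>C complex) \<Rightarrow> (nat_star \<Rightarrow>\<^sub>C complex)) set)"
  by (intro conjI allI impI Iso_not_algebraically_reflexive Aut_not_algebraically_reflexive
      unital_injective_endomorphism_in_ref_al_Aut) simp_all

end
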